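(* Let $G$ be a connected graph on $n$ vertices with transmission degree sequence $\{Tr_{1},Tr_{2},\ldots,Tr_{n}\}$, and let $0\le\alpha\le1$. Then $$\rho(G)\geq\sqrt{\frac{\sum_{i=1}^{n}Tr_{i}^{2}}{n}},$$ with equality if and only if $G$ is transmission regular.
   Context: For a connected graph $G$ with vertices $v_1,\ldots,v_n$, $Tr_i=\sum_j d(v_i,v_j)$ is the transmission degree of $v_i$; $G$ is transmission regular if all $Tr_i$ are equal. The generalized distance matrix is $\mathcal{D}_\alpha(G)=\alpha\,Tr(G)+(1-\alpha)\mathcal{D}(G)$ with $\mathcal{D}(G)$ the distance matrix and $Tr(G)=\mathrm{diag}(Tr_1,\ldots,Tr_n)$; $\rho(G)$ is its largest eigenvalue. *)

theory Defs
  imports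
    "Graph_Theory.Graph_Theory"
    "Jordan_Normal_Form.Char_Poly"
begin

text \<open>
  A finite simple graph is a \<^locale>\<open>graph\<close> of the Graph_Theory library, i.e. a finite loop-free
  symmetric digraph without parallel arcs; each edge is a pair of opposite arcs.
\<close>

text \<open>
  Length of a shortest walk. In a connected graph the infimum in \<^const>\<open>wf_digraph.\<mu>\<close> is a
  natural number, so the conversion from \<^typ>\<open>ereal\<close> loses nothing there.
\<close>

definition gdist :: "('a, 'b) pre_digraph \<Rightarrow> 'a \<Rightarrow> 'a \<Rightarrow> real" where
  "gdist G u w = real_of_ereal (wf_digraph.\<mu> G (\<lambda>_. 1) u w)"

definition transmission :: "('a, 'b) pre_digraph \<Rightarrow> 'a \<Rightarrow> real" where
  "transmission G u = (\<Sum>w\<in>verts G. gdist G u w)"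

definition transmission_regular :: "('a, 'b) pre_digraph \<Rightarrow> bool" where
  "transmission_regular G \<longleftrightarrow>
     (\<forall>u\<in>verts G. \<forall>w\<in>verts G. transmission G u = transmission G w)"

text \<open>
  The matrices depend on an enumeration \<open>v 0, \<dots>, v (n - 1)\<close> of the vertices, where \<open>n\<close> is
  the number of vertices.
\<close>

definition distance_mat :: "('a, 'b) pre_digraph \<Rightarrow> (nat \<Rightarrow> 'a) \<Rightarrow> real mat" where
  "distance_mat G v =
     mat (card (verts G)) (card (verts G)) (\<lambda>(i, j). gdist G (v i) (v j))"

definition transmission_mat :: "('a, 'b) pre_digraph \<Rightarrow> (nat \<Rightarrow> 'a) \<Rightarrow> real mat" where
  "transmission_mat G v = mat_diag (card (verts G)) (\<lambda>i. transmission G (v i))"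

definition gen_distance_mat ::
  "real \<Rightarrow> ('a, 'b) pre_digraph \<Rightarrow> (nat \<Rightarrow> 'a) \<Rightarrow> real mat" where
  "gen_distance_mat \<alpha> G v =
     \<alpha> \<cdot>\<^sub>m transmission_mat G v + (1 - \<alpha>) \<cdot>\<^sub>m distance_mat G v"

text \<open>
  Only real eigenvalues are considered; the matrices above are symmetric, hence all of their
  eigenvalues are real and (for a nonempty vertex set) the maximum exists.
\<close>

definition largest_eigenvalue :: "real mat \<Rightarrow> real" where
  "largest_eigenvalue A = Max {k. eigenvalue A k}"

end

theory Submission
  imports Defs
    "HOL-Analysis.Function_Topology"
    "Jordan_Normal_Form.Spectral_Radius"
begin

text \<open>
  Let \<open>M\<close> be the generalized distance matrix and \<open>e\<close> the all-ones vector. The row sums of \<open>M\<close>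
  are the transmissions, so \<open>M e = (Tr\<^sub>1, \<dots>, Tr\<^sub>n)\<close>. Since \<open>M\<close> is symmetric and nonnegative,
  Rayleigh quotients give \<open>-\<rho> \<le> M \<le> \<rho>\<close> as quadratic forms, hence \<open>\<parallel>M e\<parallel>\<^sup>2 \<le> \<rho>\<^sup>2 \<parallel>e\<parallel>\<^sup>2\<close>, which is
  the inequality. Equality forces \<open>w = \<rho> e - M e\<close> to satisfy \<open>M w = -\<rho> w\<close>. For \<open>n \<ge> 3\<close> and
  \<open>\<alpha> < 1\<close> the off-diagonal entries of \<open>M\<close> are positive; then a nonzero such \<open>w\<close> would have
  entries of pairwise opposite signs, which is impossible for three of them. Thus \<open>w = 0\<close>,
  i.e. all transmissions equal \<open>\<rho>\<close>. For \<open>\<alpha> = 1\<close> the matrix is diagonal and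
  nonnegative, so \<open>w = 0\<close> directly. Graphs with at most two vertices are transmission regular.
\<close>

section \<open>Bilinear forms on real functions over an index set\<close>

text \<open>Vectors are total functions of which only the values on \<open>I\<close> matter. This
  gives direct access to the product topology in the compactness argument below; the link to
  matrices is made in \<open>eigenvalue_iff_app\<close>.\<close>

definition dot :: "'i set \<Rightarrow> ('i \<Rightarrow> real) \<Rightarrow> ('i \<Rightarrow> real) \<Rightarrow> real" where
  "dot I x y = (\<Sum>i\<in>I. x i * y i)"

definition app :: "'i set \<Rightarrow> ('i \<Rightarrow> 'i \<Rightarrow> real) \<Rightarrow> ('i \<Rightarrow> real) \<Rightarrow> 'i \<Rightarrow> real" where
  "app I m x i = (\<Sum>j\<in>I. m i j * x j)"

lemma app_add: "app I m (\<lambda>i. x i + y i) i = app I m x i + app I m y i"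
  by (simp add: app_def algebra_simps sum.distrib)

lemma app_diff: "app I m (\<lambda>i. x i - y i) i = app I m x i - app I m y i"
  by (simp add: app_def algebra_simps sum_subtractf)

lemma app_scale: "app I m (\<lambda>i. c * x i) i = c * app I m x i"
  by (simp add: app_def sum_distrib_left mult.left_commute)

lemma dot_commute: "dot I x y = dot I y x"
  by (simp add: dot_def mult.commute)

lemma dot_add_left: "dot I (\<lambda>i. x i + y i) z = dot I x z + dot I y z"
  by (simp add: dot_def algebra_simps sum.distrib)

lemma dot_add_right: "dot I z (\<lambda>i. x i + y i) = dot I z x + dot I z y"
  by (simp add: dot_def algebra_simps sum.distrib)

lemma dot_diff_left: "dot I (\<lambda>i. x i - y i) z = dot I x z - dot I y z"
  by (simp add: dot_def algebra_simps sum_subtractf)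

lemma dot_diff_right: "dot I z (\<lambda>i. x i - y i) = dot I z x - dot I z y"
  by (simp add: dot_def algebra_simps sum_subtractf)

lemma dot_scale_left: "dot I (\<lambda>i. c * x i) y = c * dot I x y"
  by (simp add: dot_def sum_distrib_left mult.assoc)

lemma dot_scale_right: "dot I x (\<lambda>i. c * y i) = c * dot I x y"
  by (simp add: dot_def sum_distrib_left mult.left_commute)

lemmas bilinear_simps = app_add app_diff app_scale dot_add_left dot_add_right
  dot_diff_left dot_diff_right dot_scale_left dot_scale_right

lemma dot_self_nonneg: "0 \<le> dot I x x"
  by (simp add: dot_def sum_nonneg)

lemma dot_self_eq_0: "finite I \<Longrightarrow> dot I x x = 0 \<longleftrightarrow> (\<forall>i\<in>I. x i = 0)"
  by (simp add: dot_def sum_nonneg_eq_0_iff)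

lemma dot_cong: "(\<And>i. i \<in> I \<Longrightarrow> x i = x' i) \<Longrightarrow> (\<And>i. i \<in> I \<Longrightarrow> y i = y' i) \<Longrightarrow> dot I x y = dot I x' y'"
  by (simp add: dot_def)

lemma app_cong: "(\<And>i. i \<in> I \<Longrightarrow> x i = x' i) \<Longrightarrow> app I m x = app I m x'"
  by (simp add: app_def fun_eq_iff)

lemma quadratic_form: "dot I x (app I m x) = (\<Sum>i\<in>I. \<Sum>j\<in>I. m i j * (x i * x j))"
  by (simp add: dot_def app_def sum_distrib_left mult_ac)

lemma dot_app_sym:
  assumes "\<And>i j. i \<in> I \<Longrightarrow> j \<in> I \<Longrightarrow> m i j = m j i"
  shows "dot I (app I m x) y = dot I x (app I m y)"
proof -
  have "dot I (app I m x) y = (\<Sum>i\<in>I. \<Sum>j\<in>I. m i j * x j * y i)"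
    by (simp add: dot_def app_def sum_distrib_right)
  also have "\<dots> = (\<Sum>j\<in>I. \<Sum>i\<in>I. m i j * x j * y i)"
    by (rule sum.swap)
  also have "\<dots> = (\<Sum>j\<in>I. \<Sum>i\<in>I. m j i * x j * y i)"
    using assms by (intro sum.cong refl) simp
  also have "\<dots> = dot I x (app I m y)"
    by (simp add: dot_def app_def sum_distrib_left mult_ac)
  finally show ?thesis .
qed

section \<open>Semidefinite forms and the Rayleigh quotient\<close>

text \<open>Move from \<open>z\<close> in the direction \<open>b = m z\<close>. The form at
  \<open>z + t b\<close> is \<open>2 t N + t^2 C\<close> with \<open>N = |b|^2\<close>; its linear
  term would make it negative for small negative \<open>t\<close> unless
  \<open>N = 0\<close>.\<close>

lemma semidefinite_null_vector:
  assumes fin: "finite I"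
    and sym: "\<And>i j. i \<in> I \<Longrightarrow> j \<in> I \<Longrightarrow> m i j = m j i"
    and psd: "\<And>x. 0 \<le> dot I x (app I m x)"
    and null: "dot I z (app I m z) = 0" and "i \<in> I"
  shows "app I m z i = 0"
proof -
  define b where "b = app I m z"
  define N where "N = dot I b b"
  define C where "C = dot I b (app I m b)"
  have "C \<ge> 0" unfolding C_def by (rule psd)
  have zb: "dot I z (app I m b) = N"
    unfolding N_def by (subst dot_app_sym[OF sym, symmetric]) (simp_all add: b_def)
  have "N \<ge> 0" by (simp add: N_def dot_self_nonneg)
  \<comment> \<open>The minimiser would be \<open>- N / C\<close>; adding 1 keeps the denominator
    positive when \<open>C = 0\<close>.\<close>
  define t where "t = - N / (C + 1)"
  have "0 \<le> dot I (\<lambda>i. z i + t * b i) (app I m (\<lambda>i. z i + t * b i))"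
    by (rule psd)
  also have "\<dots> = dot I (\<lambda>i. z i + t * b i) (\<lambda>i. b i + t * app I m b i)"
    by (rule dot_cong) (simp_all add: bilinear_simps b_def)
  also have "\<dots> = 2 * t * N + t\<^sup>2 * C"
    using null zb by (simp add: bilinear_simps b_def[symmetric] N_def[symmetric] C_def[symmetric]
        power2_eq_square algebra_simps)
  finally have "0 \<le> (C + 1)\<^sup>2 * (2 * t * N + t\<^sup>2 * C)"
    by simp
  also have "\<dots> = 2 * (C + 1) * (t * (C + 1)) * N + (t * (C + 1))\<^sup>2 * C"
    by (simp add: power2_eq_square algebra_simps)
  also have "t * (C + 1) = - N"
    using \<open>C \<ge> 0\<close> by (simp add: t_def)
  finally have "N\<^sup>2 * (C + 2) \<le> 0"
    by (simp add: power2_eq_square algebra_simps)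
  then have "N = 0"
    using \<open>C \<ge> 0\<close> by (simp add: mult_le_0_iff)
  then show ?thesis
    using \<open>i \<in> I\<close> fin by (simp add: N_def dot_self_eq_0 b_def)
qed

lemma app_shift:
  assumes "finite I" "i \<in> I"
  shows "app I (\<lambda>i j. (if i = j then r else 0) - m i j) x i = r * x i - app I m x i"
proof -
  have "(\<Sum>j\<in>I. (if i = j then r else 0) * x j) = (\<Sum>j\<in>I. if i = j then r * x j else 0)"
    by (intro sum.cong) auto
  then show ?thesis
    using assms by (simp add: app_def left_diff_distrib sum_subtractf)
qed

text \<open>The form of \<open>r - m\<close> is positive semidefinite by the bound and vanishes at
  \<open>z\<close>, so \<open>z\<close> lies in its kernel.\<close>

lemma rayleigh_extremal_eigenvector:
  assumes fin: "finite I"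
    and sym: "\<And>i j. i \<in> I \<Longrightarrow> j \<in> I \<Longrightarrow> m i j = m j i"
    and bound: "\<And>x. dot I x (app I m x) \<le> r * dot I x x"
    and eq: "dot I z (app I m z) = r * dot I z z" and "i \<in> I"
  shows "app I m z i = r * z i"
proof -
  let ?s = "\<lambda>i j. (if i = j then r else 0) - m i j"
  have q: "dot I x (app I ?s x) = r * dot I x x - dot I x (app I m x)" for x
  proof -
    have "dot I x (app I ?s x) = dot I x (\<lambda>i. r * x i - app I m x i)"
      using fin by (intro dot_cong refl app_shift)
    then show ?thesis by (simp add: bilinear_simps)
  qed
  have "app I ?s z i = 0"
    by (rule semidefinite_null_vector[OF fin _ _ _ \<open>i \<in> I\<close>]) (auto simp: q sym bound eq)
  then show ?thesis
    using app_shift[OF fin \<open>i \<in> I\<close>] by simp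
qed

text \<open>The form attains its maximum \<open>r\<close> on the compact unit sphere, homogeneity
  extends the bound to all vectors, and the maximiser is extremal, hence an eigenvector.\<close>

lemma rayleigh_max_exists:
  fixes I :: "'i set"
  assumes fin: "finite I" and ne: "I \<noteq> {}"
    and sym: "\<And>i j. i \<in> I \<Longrightarrow> j \<in> I \<Longrightarrow> m i j = m j i"
  obtains r z where "\<And>x. dot I x (app I m x) \<le> r * dot I x x"
    and "\<exists>i\<in>I. z i \<noteq> 0" and "\<And>i. i \<in> I \<Longrightarrow> app I m z i = r * z i"
proof -
  \<comment> \<open>Coordinates outside \<open>I\<close> are pinned to 0, so \<open>K\<close> is a
    product of compact sets over the whole type and Tychonoff's theorem applies.\<close>
  define K where "K = Pi\<^sub>E (UNIV :: 'i set) (\<lambda>i. if i \<in> I then {-1..1} else {0 :: real})"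
  define S where "S = K \<inter> {x. dot I x x = 1}"
  have "compactin (product_topology (\<lambda>i. euclidean) UNIV) K"
    unfolding K_def by (subst compactin_PiE) auto
  then have "compact K"
    by (simp add: euclidean_product_topology)
  have cont: "continuous_on UNIV (\<lambda>x::'i \<Rightarrow> real. dot I x x)"
    "continuous_on A (\<lambda>x::'i \<Rightarrow> real. dot I x (app I m x))" for A
    unfolding dot_def app_def
    by (intro continuous_intros continuous_on_subset[OF continuous_on_product_coordinates] subset_UNIV)+
  have "closed {x::'i \<Rightarrow> real. dot I x x = 1}"
    by (intro closed_Collect_eq cont continuous_intros)
  then have "compact S"
    unfolding S_def using \<open>compact K\<close> by (rule compact_Int_closed[rotated])
  obtain k where "k \<in> I" using ne by blast
  have "dot I (\<lambda>i. if i = k then 1 else 0) (\<lambda>i. if i = k then 1 else 0) = (\<Sum>i\<in>I. if i = k then 1 else 0)"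
    unfolding dot_def by (intro sum.cong) auto
  then have "(\<lambda>i. if i = k then 1 else 0) \<in> S"
    using \<open>k \<in> I\<close> fin by (auto simp: S_def K_def)
  then have "S \<noteq> {}" by blast
  obtain z where "z \<in> S" and max: "\<And>y. y \<in> S \<Longrightarrow> dot I y (app I m y) \<le> dot I z (app I m z)"
    using continuous_attains_sup[OF \<open>compact S\<close> \<open>S \<noteq> {}\<close> cont(2)] by blast
  define r where "r = dot I z (app I m z)"
  have z1: "dot I z z = 1" using \<open>z \<in> S\<close> by (simp add: S_def)
  have bound: "dot I x (app I m x) \<le> r * dot I x x" for x
  proof (cases "dot I x x = 0")
    case True
    then have "\<forall>i\<in>I. x i = 0" using fin by (simp add: dot_self_eq_0)
    then show ?thesis by (simp add: dot_def)
  next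
    case False
    define s where "s = sqrt (dot I x x)"
    have "s > 0" "s\<^sup>2 = dot I x x"
      using False dot_self_nonneg[of I x] by (auto simp: s_def)
    \<comment> \<open>Besides being normalised, \<open>x\<close> is cut off outside \<open>I\<close>
      so that \<open>y\<close> lies in \<open>K\<close>; neither form sees the cut.\<close>
    define y where "y i = (if i \<in> I then (1 / s) * x i else 0)" for i
    have y: "dot I y y = (1 / s)\<^sup>2 * dot I x x"
    proof -
      have "dot I y y = dot I (\<lambda>i. (1 / s) * x i) (\<lambda>i. (1 / s) * x i)"
        by (rule dot_cong) (auto simp: y_def)
      then show ?thesis by (simp only: bilinear_simps) (simp add: power2_eq_square)
    qed
    have qy: "dot I y (app I m y) = (1 / s)\<^sup>2 * dot I x (app I m x)"
    proof -
      have "app I m y = app I m (\<lambda>i. (1 / s) * x i)"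
        by (rule app_cong) (simp add: y_def)
      then have "dot I y (app I m y) = dot I (\<lambda>i. (1 / s) * x i) (\<lambda>i. (1 / s) * app I m x i)"
        by (intro dot_cong) (simp_all only: app_scale, simp_all add: y_def)
      then show ?thesis by (simp only: bilinear_simps) (simp add: power2_eq_square)
    qed
    have y1: "dot I y y = 1"
      using \<open>s > 0\<close> \<open>s\<^sup>2 = dot I x x\<close>[symmetric] by (simp add: y power_divide)
    have "\<bar>y i\<bar> \<le> 1" if "i \<in> I" for i
    proof -
      have "y i * y i \<le> dot I y y"
        unfolding dot_def using fin that by (intro member_le_sum) auto
      then show ?thesis using y1 by (metis abs_square_le_1 power2_eq_square)
    qed
    then have "y i \<in> (if i \<in> I then {-1..1} else {0})" for i
      by (cases "i \<in> I") (simp add: abs_le_iff minus_le_iff, simp add: y_def)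
    then have "y \<in> K"
      by (simp add: K_def PiE_UNIV_domain)
    then have "(1 / s)\<^sup>2 * dot I x (app I m x) \<le> r"
      using max[of y] y1 by (simp add: S_def r_def qy)
    then show ?thesis
      using \<open>s > 0\<close> \<open>s\<^sup>2 = dot I x x\<close>[symmetric] by (simp add: power_divide field_simps)
  qed
  show thesis
  proof
    show "dot I x (app I m x) \<le> r * dot I x x" for x by (rule bound)
    show "\<exists>i\<in>I. z i \<noteq> 0" using z1 dot_self_eq_0[OF fin, of z] by auto
    show "app I m z i = r * z i" if "i \<in> I" for i
      by (rule rayleigh_extremal_eigenvector[OF fin sym bound _ that]) (simp_all add: z1 r_def)
  qed
qed

section \<open>Nonnegative symmetric matrices\<close>

lemma abs_quadratic_form_le:
  assumes "\<And>i j. i \<in> I \<Longrightarrow> j \<in> I \<Longrightarrow> 0 \<le> m i j"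
  shows "\<bar>dot I x (app I m x)\<bar> \<le> dot I (\<lambda>i. \<bar>x i\<bar>) (app I m (\<lambda>i. \<bar>x i\<bar>))"
proof -
  have "\<bar>dot I x (app I m x)\<bar> \<le> (\<Sum>i\<in>I. \<bar>\<Sum>j\<in>I. m i j * (x i * x j)\<bar>)"
    unfolding quadratic_form by (rule sum_abs)
  also have "\<dots> \<le> (\<Sum>i\<in>I. \<Sum>j\<in>I. \<bar>m i j * (x i * x j)\<bar>)"
    by (intro sum_mono sum_abs)
  also have "\<dots> = dot I (\<lambda>i. \<bar>x i\<bar>) (app I m (\<lambda>i. \<bar>x i\<bar>))"
    unfolding quadratic_form using assms by (intro sum.cong refl) (simp add: abs_mult)
  finally show ?thesis .
qed

lemma dot_abs_self: "dot I (\<lambda>i. \<bar>x i\<bar>) (\<lambda>i. \<bar>x i\<bar>) = dot I x x"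
  by (simp add: dot_def flip: abs_mult)

text \<open>Comparison with absolute values turns the upper bound \<open>r\<close> into the lower
  bound \<open>-r\<close>, so \<open>r - m\<close> and \<open>r + m\<close> are both semidefinite.
  The gap in the norm inequality is, up to the factor \<open>2 * r\<close>, a sum of values of these
  two forms. If the gap is 0, the form of \<open>r + m\<close> vanishes at
  \<open>w = r x - m x\<close>, which puts \<open>w\<close> in its kernel.\<close>

lemma app_norm_bound:
  fixes m :: "'i \<Rightarrow> 'i \<Rightarrow> real"
  assumes fin: "finite I"
    and sym: "\<And>i j. i \<in> I \<Longrightarrow> j \<in> I \<Longrightarrow> m i j = m j i"
    and nonneg: "\<And>i j. i \<in> I \<Longrightarrow> j \<in> I \<Longrightarrow> 0 \<le> m i j"
    and bound: "\<And>x. dot I x (app I m x) \<le> r * dot I x x" and "r > 0"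
  shows "dot I (app I m x) (app I m x) \<le> r\<^sup>2 * dot I x x"
    and "dot I (app I m x) (app I m x) = r\<^sup>2 * dot I x x \<Longrightarrow> i \<in> I \<Longrightarrow>
      app I m (\<lambda>i. r * x i - app I m x i) i = - r * (r * x i - app I m x i)"
proof -
  have lower: "0 \<le> r * dot I y y + dot I y (app I m y)" for y
    using abs_quadratic_form_le[of I m y, OF nonneg] bound[of "\<lambda>i. \<bar>y i\<bar>"]
    by (simp add: dot_abs_self)
  have upper: "0 \<le> r * dot I y y - dot I y (app I m y)" for y
    using bound[of y] by simp
  define u where "u i = r * x i + app I m x i" for i
  define w where "w i = r * x i - app I m x i" for i
  have au: "app I m u = (\<lambda>i. r * app I m x i + app I m (app I m x) i)"
    unfolding u_def by (rule ext) (simp only: bilinear_simps)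
  have aw: "app I m w = (\<lambda>i. r * app I m x i - app I m (app I m x) i)"
    unfolding w_def by (rule ext) (simp only: bilinear_simps)
  have s1: "dot I x (app I m (app I m x)) = dot I (app I m x) (app I m x)"
    using dot_app_sym[of I m x "app I m x", OF sym] by simp
  have s2: "dot I (app I m x) x = dot I x (app I m x)"
    by (rule dot_commute)
  \<comment> \<open>With \<open>P = r - m\<close> and \<open>Q = r + m\<close>, this is the identity \<open>2 r P Q = P Q P + Q P Q\<close>.\<close>
  have id: "2 * r * (r\<^sup>2 * dot I x x - dot I (app I m x) (app I m x)) =
      (r * dot I w w + dot I w (app I m w)) + (r * dot I u u - dot I u (app I m u))"
    unfolding au aw unfolding u_def w_def
    by (simp add: bilinear_simps s1 s2 algebra_simps power2_eq_square)
  then have "0 \<le> 2 * r * (r\<^sup>2 * dot I x x - dot I (app I m x) (app I m x))"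
    using lower[of w] upper[of u] by linarith
  then show "dot I (app I m x) (app I m x) \<le> r\<^sup>2 * dot I x x"
    using \<open>r > 0\<close> by (simp add: zero_le_mult_iff)
  show "app I m (\<lambda>i. r * x i - app I m x i) i = - r * (r * x i - app I m x i)"
    if eq: "dot I (app I m x) (app I m x) = r\<^sup>2 * dot I x x" and "i \<in> I"
  proof -
    \<comment> \<open>Extremality was treated for upper bounds only; for \<open>- m\<close> the
      upper bound \<open>r\<close> is attained at \<open>w\<close>.\<close>
    let ?n = "\<lambda>i j. - m i j"
    have neg: "app I ?n y i = - app I m y i" for y i
      by (simp add: app_def sum_negf)
    have dneg: "dot I y (app I ?n y) = - dot I y (app I m y)" for y
      by (simp add: neg dot_def sum_negf)
    have "r * dot I w w + dot I w (app I m w) = 0"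
      using id eq lower[of w] upper[of u] by simp
    then have "app I ?n w i = r * w i"
      using lower sym
      by (intro rayleigh_extremal_eigenvector[OF fin _ _ _ \<open>i \<in> I\<close>]) (simp_all add: dneg add.commute, smt (verit))
    then show ?thesis
      by (simp add: neg w_def[abs_def])
  qed
qed

text \<open>If \<open>w\<close> is nonzero, \<open>|w|\<close> is an eigenvector for
  \<open>r\<close> with all entries positive. Comparing the forms at \<open>w\<close> and
  \<open>|w|\<close> then forces every two distinct entries of \<open>w\<close> to have opposite
  signs.\<close>

lemma no_negative_extremal_eigenvector:
  fixes m :: "'i \<Rightarrow> 'i \<Rightarrow> real"
  assumes fin: "finite I"
    and sym: "\<And>i j. i \<in> I \<Longrightarrow> j \<in> I \<Longrightarrow> m i j = m j i"
    and nonneg: "\<And>i j. i \<in> I \<Longrightarrow> j \<in> I \<Longrightarrow> 0 \<le> m i j"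
    and pos: "\<And>i j. i \<in> I \<Longrightarrow> j \<in> I \<Longrightarrow> i \<noteq> j \<Longrightarrow> 0 < m i j"
    and bound: "\<And>x. dot I x (app I m x) \<le> r * dot I x x"
    and eig: "\<And>i. i \<in> I \<Longrightarrow> app I m w i = - r * w i"
    and card: "card I \<ge> 3" and "k \<in> I"
  shows "w k = 0"
proof (rule ccontr)
  assume "w k \<noteq> 0"
  define a where "a = (\<lambda>i. \<bar>w i\<bar>)"
  have "dot I w (app I m w) = dot I w (\<lambda>i. - r * w i)"
    by (intro dot_cong refl eig)
  then have qw: "dot I w (app I m w) = - r * dot I w w"
    by (simp only: bilinear_simps)
  \<comment> \<open>The value at \<open>a\<close> is squeezed: at least the absolute value of the
    form at \<open>w\<close>, and at most \<open>r\<close> times the squared norm.\<close>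
  then have qa: "dot I a (app I m a) = r * dot I w w"
    using abs_quadratic_form_le[of I m w, OF nonneg] bound[of a]
    by (simp add: a_def dot_abs_self)
  have eiga: "app I m a i = r * a i" if "i \<in> I" for i
    by (rule rayleigh_extremal_eigenvector[OF fin sym bound _ that])
      (simp_all add: qa, simp add: a_def dot_abs_self)
  have apos: "a i > 0" if "i \<in> I" for i
  proof (rule ccontr)
    assume "\<not> a i > 0"
    then have "a i = 0" by (simp add: a_def)
    then have "i \<noteq> k" using \<open>w k \<noteq> 0\<close> by (auto simp: a_def)
    \<comment> \<open>A zero entry of \<open>a\<close> would make row \<open>i\<close> of the
      eigenvector equation vanish, although its term at \<open>k\<close> is positive.\<close>
    have "m i k * a k \<le> app I m a i"
      unfolding app_def using that nonneg \<open>k \<in> I\<close> fin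
      by (intro member_le_sum) (auto simp: a_def)
    moreover have "0 < m i k * a k"
      using pos[OF that \<open>k \<in> I\<close> \<open>i \<noteq> k\<close>] \<open>w k \<noteq> 0\<close> by (simp add: a_def)
    ultimately show False using eiga[OF that] \<open>a i = 0\<close> by simp
  qed
  \<comment> \<open>The values \<open>r |w|^2\<close> at \<open>a\<close> and
    \<open>- r |w|^2\<close> at \<open>w\<close> cancel. All summands are nonnegative, so each is
    zero.\<close>
  have total: "(\<Sum>i\<in>I. \<Sum>j\<in>I. m i j * (a i * a j + w i * w j)) = 0"
    using qa qw by (simp add: quadratic_form distrib_left sum.distrib)
  have nn: "0 \<le> m i j * (a i * a j + w i * w j)" if "i \<in> I" "j \<in> I" for i j
  proof -
    have "- (w i * w j) \<le> a i * a j"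
      unfolding a_def abs_mult[symmetric] by simp
    then show ?thesis using nonneg that by simp
  qed
  have rows: "(\<Sum>j\<in>I. m i j * (a i * a j + w i * w j)) = 0" if "i \<in> I" for i
  proof (rule sum_nonneg_0[OF fin _ total that])
    show "0 \<le> (\<Sum>j\<in>I. m i j * (a i * a j + w i * w j))" if "i \<in> I" for i
      using nn[OF that] by (rule sum_nonneg)
  qed
  then have zero: "m i j * (a i * a j + w i * w j) = 0" if "i \<in> I" "j \<in> I" for i j
  proof -
    show ?thesis
      by (rule sum_nonneg_0[OF fin _ rows[OF that(1)] that(2)]) (rule nn[OF that(1)])
  qed
  have opp: "w i * w j < 0" if "i \<in> I" "j \<in> I" "i \<noteq> j" for i j
    using zero[of i j] pos[of i j] mult_pos_pos[OF apos[of i] apos[of j]] that by simp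
  obtain T where "T \<subseteq> I" "card T = 3"
    by (rule obtain_subset_with_card_n[OF card])
  then obtain p q s where "p \<in> I" "q \<in> I" "s \<in> I" "p \<noteq> q" "q \<noteq> s" "p \<noteq> s"
    by (auto simp: card_3_iff)
  then have "w p * w q < 0" "w q * w s < 0" "w p * w s < 0"
    using opp by auto
  then show False by (auto simp: mult_less_0_iff)
qed

section \<open>Distances in a connected graph\<close>

context
  fixes G :: "('a, 'b) pre_digraph"
  assumes graph: "graph G" and conn: "Digraph_Component.connected G"
begin

interpretation graph G by (rule graph)

lemma awalk_cost_1: "awalk_cost (\<lambda>_. 1) p = real (length p)"
  by (induction p) (auto simp: awalk_cost_def)

text \<open>An edge is a pair of distinct opposite arcs, so the reverse walk is built by choosing an
  opposite arc at each step. Equal lengths make the distance symmetric.\<close>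

lemma awalk_reverse:
  assumes "awalk u p w"
  obtains q where "awalk w q u" "length q = length p"
proof -
  have "\<exists>q. awalk w q u \<and> length q = length p"
    using assms
  proof (induction p arbitrary: u)
    case Nil
    then show ?case by (auto simp: awalk_Nil_iff)
  next
    case (Cons e p)
    then have e: "e \<in> arcs G" "u = tail G e" "awalk (head G e) p w"
      by (auto simp: awalk_Cons_iff)
    obtain q where q: "awalk w q (head G e)" "length q = length p"
      using Cons.IH[OF e(3)] by blast
    have "(head G e, tail G e) \<in> arcs_ends G"
      using e(1) graph_symmetric by (auto simp: arcs_ends_def arc_to_ends_def)
    then obtain f where "f \<in> arcs G" "tail G f = head G e" "head G f = tail G e"
      by (auto simp: arcs_ends_def arc_to_ends_def)
    then have "awalk (head G e) [f] u"
      using e by (auto simp: awalk_Cons_iff awalk_Nil_iff)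
    with q have "awalk w (q @ [f]) u" "length (q @ [f]) = length (e # p)"
      by (auto intro: awalk_appendI)
    then show ?case by blast
  qed
  then show thesis using that by blast
qed

lemma mu_commute: "\<mu> (\<lambda>_. 1) u w = \<mu> (\<lambda>_. 1) w u"
proof -
  have "\<mu> (\<lambda>_. 1) u w \<le> \<mu> (\<lambda>_. 1) w u" for u w
    unfolding \<mu>_def
  proof (rule INF_mono)
    fix p assume "p \<in> {p. awalk w p u}"
    then obtain q where "awalk u q w" "length q = length p"
      using awalk_reverse by blast
    then show "\<exists>q\<in>{p. awalk u p w}. ereal (awalk_cost (\<lambda>_. 1) q) \<le> ereal (awalk_cost (\<lambda>_. 1) p)"
      by (auto simp: awalk_cost_1 intro!: exI[of _ q])
  qed
  then show ?thesis by (intro antisym)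
qed

lemma gdist_commute: "gdist G u w = gdist G w u"
  by (simp add: gdist_def mu_commute)

lemma gdist_nonneg: "0 \<le> gdist G u w"
proof -
  have "0 \<le> \<mu> (\<lambda>_. 1) u w"
    unfolding \<mu>_def by (auto intro!: INF_greatest simp: awalk_cost_1)
  then show ?thesis by (simp add: gdist_def real_of_ereal_pos)
qed

text \<open>\<open>real_of_ereal\<close> sends infinity to 0, so the lower bound 1 on walk lengths
  is not enough: connectedness supplies a walk, which makes the infimum finite.\<close>

lemma gdist_pos:
  assumes "u \<in> verts G" "w \<in> verts G" "u \<noteq> w"
  shows "0 < gdist G u w"
proof -
  obtain p where p: "awalk u p w"
    using conn assms
    unfolding connected_def strongly_connected_def reachable_mk_symmetric_eq[OF sym_arcs]
    by (auto simp: reachable_awalk)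
  have "1 \<le> \<mu> (\<lambda>_. 1) u w"
    unfolding \<mu>_def
  proof (rule INF_greatest)
    fix q assume "q \<in> {p. awalk u p w}"
    then have "q \<noteq> []" using \<open>u \<noteq> w\<close> by (auto simp: awalk_Nil_iff)
    then show "1 \<le> ereal (awalk_cost (\<lambda>_. 1) q)"
      by (cases q) (auto simp: awalk_cost_1 one_ereal_def)
  qed
  moreover have "\<mu> (\<lambda>_. 1) u w \<le> ereal (awalk_cost (\<lambda>_. 1) p)"
    by (rule min_cost_le_walk_cost[OF p])
  ultimately show ?thesis
    unfolding gdist_def by (cases "\<mu> (\<lambda>_. 1) u w") (auto simp: one_ereal_def)
qed

lemma gdist_self:
  assumes "u \<in> verts G"
  shows "gdist G u u = 0"
proof -
  have "awalk u [] u" using assms by (simp add: awalk_Nil_iff)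
  then have "\<mu> (\<lambda>_. 1) u u \<le> 0"
    using min_cost_le_walk_cost[of u "[]" u "\<lambda>_. 1"] by (simp add: awalk_cost_1 zero_ereal_def)
  moreover have "0 \<le> \<mu> (\<lambda>_. 1) u u"
    unfolding \<mu>_def by (auto intro!: INF_greatest simp: awalk_cost_1)
  ultimately show ?thesis by (simp add: gdist_def)
qed

end

section \<open>Eigenvalues of real matrices\<close>

lemma eigenvalue_iff_app:
  fixes A :: "real mat"
  assumes "A \<in> carrier_mat n n"
  shows "eigenvalue A k \<longleftrightarrow> (\<exists>x. (\<exists>i<n. x i \<noteq> 0) \<and>
    (\<forall>i<n. app {..<n} (\<lambda>i j. A $$ (i, j)) x i = k * x i))"
proof
  assume "eigenvalue A k"
  then obtain x where x: "x \<in> carrier_vec n" "x \<noteq> 0\<^sub>v n" "A *\<^sub>v x = k \<cdot>\<^sub>v x"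
    using assms by (auto simp: eigenvalue_def eigenvector_def)
  have "app {..<n} (\<lambda>i j. A $$ (i, j)) (\<lambda>i. x $ i) i = k * x $ i" if "i < n" for i
  proof -
    have "app {..<n} (\<lambda>i j. A $$ (i, j)) (\<lambda>i. x $ i) i = (A *\<^sub>v x) $ i"
      using that x(1) assms by (auto simp: app_def scalar_prod_def lessThan_atLeast0 intro!: sum.cong)
    then show ?thesis using x that by simp
  qed
  moreover have "\<exists>i<n. x $ i \<noteq> 0"
    using x by (metis carrier_vecD eq_vecI index_zero_vec)
  ultimately show "\<exists>x. (\<exists>i<n. x i \<noteq> 0) \<and>
    (\<forall>i<n. app {..<n} (\<lambda>i j. A $$ (i, j)) x i = k * x i)"
    by blast
next
  assume "\<exists>x. (\<exists>i<n. x i \<noteq> 0) \<and> (\<forall>i<n. app {..<n} (\<lambda>i j. A $$ (i, j)) x i = k * x i)"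
  then obtain x i where i: "i < n" "x i \<noteq> 0"
    and x: "\<forall>i<n. app {..<n} (\<lambda>i j. A $$ (i, j)) x i = k * x i" by blast
  have "A *\<^sub>v vec n x = k \<cdot>\<^sub>v vec n x"
  proof (rule eq_vecI)
    fix j assume "j < dim_vec (k \<cdot>\<^sub>v vec n x)"
    then have "j < n" by simp
    then have "(A *\<^sub>v vec n x) $ j = app {..<n} (\<lambda>i j. A $$ (i, j)) x j"
      using assms by (auto simp: app_def scalar_prod_def lessThan_atLeast0 intro!: sum.cong)
    then show "(A *\<^sub>v vec n x) $ j = (k \<cdot>\<^sub>v vec n x) $ j"
      using x \<open>j < n\<close> by simp
  qed (use assms in auto)
  moreover have "vec n x \<noteq> 0\<^sub>v n"
    using i by (metis index_vec index_zero_vec(1))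
  ultimately show "eigenvalue A k"
    using assms unfolding eigenvalue_def eigenvector_def
    by (intro exI[of _ "vec n x"]) auto
qed

text \<open>The maximal Rayleigh quotient is itself an eigenvalue, and every eigenvalue is the
  Rayleigh quotient of its eigenvector. Finiteness of the spectrum then identifies it with the
  \<open>Max\<close>.\<close>

lemma largest_eigenvalue_rayleigh:
  fixes A :: "real mat"
  assumes A: "A \<in> carrier_mat n n" and "n > 0"
    and sym: "\<And>i j. i < n \<Longrightarrow> j < n \<Longrightarrow> A $$ (i, j) = A $$ (j, i)"
  shows "dot {..<n} x (app {..<n} (\<lambda>i j. A $$ (i, j)) x) \<le> largest_eigenvalue A * dot {..<n} x x"
    and "eigenvalue A (largest_eigenvalue A)"
proof -
  let ?m = "\<lambda>i j. A $$ (i, j)"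
  obtain r z where bound: "\<And>x. dot {..<n} x (app {..<n} ?m x) \<le> r * dot {..<n} x x"
    and z: "\<exists>i\<in>{..<n}. z i \<noteq> 0" "\<And>i. i \<in> {..<n} \<Longrightarrow> app {..<n} ?m z i = r * z i"
    by (rule rayleigh_max_exists[of "{..<n}" ?m]) (use sym \<open>n > 0\<close> in auto)
  have ev: "eigenvalue A r"
    unfolding eigenvalue_iff_app[OF A] using z by auto
  have "k \<le> r" if k: "eigenvalue A k" for k
  proof -
    obtain x where x: "\<exists>i<n. x i \<noteq> 0" "\<forall>i<n. app {..<n} ?m x i = k * x i"
      using k unfolding eigenvalue_iff_app[OF A] by blast
    have "dot {..<n} x (app {..<n} ?m x) = dot {..<n} x (\<lambda>i. k * x i)"
      using x by (intro dot_cong) auto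
    then have "k * dot {..<n} x x \<le> r * dot {..<n} x x"
      using bound[of x] by (simp only: bilinear_simps)
    moreover have "dot {..<n} x x > 0"
      using x(1) dot_self_eq_0[of "{..<n}" x] dot_self_nonneg[of "{..<n}" x] by fastforce
    ultimately show ?thesis by simp
  qed
  moreover have "finite {k. eigenvalue A k}"
    using card_finite_spectrum(1)[OF A] by (simp add: spectrum_def)
  ultimately have "largest_eigenvalue A = r"
    unfolding largest_eigenvalue_def using ev by (intro Max_eqI) auto
  then show "dot {..<n} x (app {..<n} ?m x) \<le> largest_eigenvalue A * dot {..<n} x x"
    "eigenvalue A (largest_eigenvalue A)"
    using bound ev by auto
qed

text \<open>Read the eigenvector equation in a row \<open>i\<close> where \<open>|x i|\<close>
  attains its maximum \<open>c\<close>. For a transmission regular graph this bounds the largest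
  eigenvalue from above.\<close>

lemma eigenvalue_le_constant_row_sum:
  fixes A :: "real mat"
  assumes A: "A \<in> carrier_mat n n"
    and nonneg: "\<And>i j. i < n \<Longrightarrow> j < n \<Longrightarrow> 0 \<le> A $$ (i, j)"
    and rows: "\<And>i. i < n \<Longrightarrow> (\<Sum>j<n. A $$ (i, j)) = t"
    and "eigenvalue A k"
  shows "k \<le> t"
proof -
  obtain x l where l: "l < n" "x l \<noteq> 0"
    and x: "\<forall>i<n. app {..<n} (\<lambda>i j. A $$ (i, j)) x i = k * x i"
    using \<open>eigenvalue A k\<close> unfolding eigenvalue_iff_app[OF A] by blast
  define c where "c = Max ((\<lambda>i. \<bar>x i\<bar>) ` {..<n})"
  have c: "\<bar>x i\<bar> \<le> c" if "i < n" for i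
    unfolding c_def using that by (intro Max_ge) auto
  have "c \<in> (\<lambda>i. \<bar>x i\<bar>) ` {..<n}"
    unfolding c_def using l by (intro Max_in) auto
  then obtain i where i: "i < n" "\<bar>x i\<bar> = c" by auto
  have "c > 0" using c[OF l(1)] l(2) by linarith
  have "k * c \<le> \<bar>k * x i\<bar>" using i \<open>c > 0\<close> by (simp add: abs_mult mult_right_mono)
  also have "\<dots> = \<bar>\<Sum>j<n. A $$ (i, j) * x j\<bar>" using x i by (simp add: app_def)
  also have "\<dots> \<le> (\<Sum>j<n. \<bar>A $$ (i, j) * x j\<bar>)" by (rule sum_abs)
  also have "\<dots> \<le> (\<Sum>j<n. A $$ (i, j) * c)"
    using nonneg i c by (intro sum_mono) (auto simp: abs_mult intro!: mult_mono)
  also have "\<dots> = t * c" using rows[OF i(1)] by (simp flip: sum_distrib_right)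
  finally show ?thesis using \<open>c > 0\<close> by simp
qed

section \<open>The bound and its equality case\<close>

theorem theorem4p3:
  fixes G :: "('a, 'b) pre_digraph" and v :: "nat \<Rightarrow> 'a" and n :: nat and \<alpha> :: real
  assumes "graph G"
    and "Digraph_Component.connected G"
    and "n = card (verts G)"
    and "bij_betw v {..<n} (verts G)"
    and "0 \<le> \<alpha>" and "\<alpha> \<le> 1"
  defines "\<rho> \<equiv> largest_eigenvalue (gen_distance_mat \<alpha> G v)"
  shows "\<rho> \<ge> sqrt ((\<Sum>i<n. (transmission G (v i))\<^sup>2) / real n) \<and>
    (\<rho> = sqrt ((\<Sum>i<n. (transmission G (v i))\<^sup>2) / real n) \<longleftrightarrow> transmission_regular G)"
proof -
  interpret graph G by fact
  note conn = \<open>Digraph_Component.connected G\<close>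
  have "verts G \<noteq> {}"
    using conn by (auto simp: connected_def strongly_connected_def)
  then have "n > 0" using assms(3) by (simp add: card_gt_0_iff)
  define T where "T i = transmission G (v i)" for i
  define M where "M = gen_distance_mat \<alpha> G v"
  define m where "m i j = M $$ (i, j)" for i j
  define d where "d i j = gdist G (v i) (v j)" for i j
  let ?I = "{..<n}"
  have vv: "v i \<in> verts G" if "i < n" for i
    using assms(4) that by (auto simp: bij_betw_def)
  have vinj: "v i \<noteq> v j" if "i < n" "j < n" "i \<noteq> j" for i j
    using assms(4) that by (auto simp: bij_betw_def inj_on_def)
  have T: "T i = (\<Sum>j<n. d i j)" for i
    unfolding T_def transmission_def d_def using sum.reindex_bij_betw[OF assms(4)] by metis
  have d_sym: "d i j = d j i" for i j
    unfolding d_def by (rule gdist_commute[OF \<open>graph G\<close> conn])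
  have d_nonneg: "0 \<le> d i j" for i j
    unfolding d_def by (rule gdist_nonneg[OF \<open>graph G\<close> conn])
  have d_pos: "0 < d i j" if "i < n" "j < n" "i \<noteq> j" for i j
    unfolding d_def using that vv vinj by (intro gdist_pos[OF \<open>graph G\<close> conn]) auto
  have d_self: "d i i = 0" if "i < n" for i
    unfolding d_def using that vv by (intro gdist_self[OF \<open>graph G\<close> conn]) auto
  have M: "M \<in> carrier_mat n n"
    by (simp add: M_def gen_distance_mat_def transmission_mat_def distance_mat_def mat_diag_def
        assms(3))
  have m: "m i j = (if i = j then \<alpha> * T i else 0) + (1 - \<alpha>) * d i j" if "i < n" "j < n" for i j
    using that by (simp add: m_def M_def gen_distance_mat_def transmission_mat_def
        distance_mat_def mat_diag_def d_def T_def flip: assms(3))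
  have T_nonneg: "0 \<le> T i" for i
    unfolding T using d_nonneg by (simp add: sum_nonneg)
  have m_sym: "m i j = m j i" if "i < n" "j < n" for i j
    using that by (simp add: m d_sym)
  have m_nonneg: "0 \<le> m i j" if "i < n" "j < n" for i j
    using that assms(5,6) T_nonneg d_nonneg by (simp add: m)
  have rows: "(\<Sum>j<n. m i j) = T i" if "i < n" for i
  proof -
    have "(\<Sum>j<n. m i j) = (\<Sum>j<n. (if i = j then \<alpha> * T i else 0) + (1 - \<alpha>) * d i j)"
      using that by (intro sum.cong) (auto simp: m)
    also have "\<dots> = \<alpha> * T i + (1 - \<alpha>) * T i"
      using that by (simp add: sum.distrib T[of i] flip: sum_distrib_left)
    finally show ?thesis by (simp add: algebra_simps)
  qed
  have reg: "transmission_regular G \<longleftrightarrow> (\<forall>i<n. \<forall>j<n. T i = T j)"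
  proof -
    have "verts G = v ` ?I" using assms(4) by (simp add: bij_betw_def)
    then show ?thesis by (auto simp: transmission_regular_def T_def)
  qed
  have bound: "\<And>x. dot ?I x (app ?I m x) \<le> \<rho> * dot ?I x x"
    and ev: "eigenvalue M \<rho>"
    using largest_eigenvalue_rayleigh[OF M \<open>n > 0\<close>] m_sym
    by (simp_all add: \<rho>_def M_def[symmetric] m_def[abs_def])
  let ?S = "(\<Sum>i<n. (T i)\<^sup>2)"
  have one: "app ?I m (\<lambda>_. 1) i = T i" if "i < n" for i
    using rows[OF that] by (simp add: app_def)
  have dot1: "dot ?I (\<lambda>_. 1) (\<lambda>_. 1) = real n" by (simp add: dot_def)
  have sumT: "(\<Sum>i<n. T i) \<le> \<rho> * real n"
    using bound[of "\<lambda>_. 1"] one by (simp add: dot_def)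
  have dotT: "dot ?I (app ?I m (\<lambda>_. 1)) (app ?I m (\<lambda>_. 1)) = ?S"
    using one by (simp add: dot_def power2_eq_square)
  have "\<rho> \<ge> sqrt (?S / real n) \<and> (\<rho> = sqrt (?S / real n) \<longleftrightarrow> (\<forall>i<n. \<forall>j<n. T i = T j))"
  \<comment> \<open>Equality is shown in the regular case and strict inequality otherwise, which
    gives both directions. The regular case also covers a single vertex, where
    \<open>\<rho> = 0\<close> and \<open>app_norm_bound\<close> does not apply.\<close>
  proof (cases "\<forall>i<n. \<forall>j<n. T i = T j")
    case True
    define t where "t = T 0"
    have t: "T i = t" if "i < n" for i using True that \<open>n > 0\<close> unfolding t_def by blast
    have "t \<ge> 0" using T_nonneg[of 0] by (simp add: t_def)
    have "\<rho> \<le> t"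
      using eigenvalue_le_constant_row_sum[OF M _ _ ev] m_nonneg rows t by (simp add: m_def)
    moreover have "t \<le> \<rho>" using sumT t \<open>n > 0\<close> by simp
    ultimately have "\<rho> = t" by simp
    moreover have "sqrt (?S / real n) = t"
      using t \<open>n > 0\<close> \<open>t \<ge> 0\<close> by simp
    ultimately show ?thesis using True by (metis order_refl)
  next
    case False
    have "n \<noteq> 1" using False by auto
    moreover have "n \<noteq> 2"
    proof
      assume n2: "n = 2"
      \<comment> \<open>With two vertices both transmissions equal the one distance
        \<open>d 0 1\<close>.\<close>
      have "T 0 = T 1"
        using d_sym[of 0 1] d_self[of 0] d_self[of 1] n2 by (simp add: T numeral_2_eq_2)
      then have "T i = T j" if "i < 2" "j < 2" for i j
        using that by (auto simp: less_2_cases_iff)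
      with False n2 show False by blast
    qed
    ultimately have n3: "n \<ge> 3" using \<open>n > 0\<close> by linarith
    have "0 < d 0 1" using d_pos n3 by simp
    also have "\<dots> \<le> T 0"
      unfolding T using d_nonneg n3 by (intro member_le_sum) auto
    also have "\<dots> \<le> (\<Sum>i<n. T i)"
      using T_nonneg n3 by (intro member_le_sum) auto
    finally have "0 < \<rho> * real n" using sumT by linarith
    then have "\<rho> > 0" using \<open>n > 0\<close> by (simp add: zero_less_mult_iff)
    have le: "?S \<le> \<rho>\<^sup>2 * real n"
      and eq: "\<And>i. ?S = \<rho>\<^sup>2 * real n \<Longrightarrow> i \<in> ?I \<Longrightarrow> app ?I m (\<lambda>i. \<rho> * 1 - app ?I m (\<lambda>_. 1) i) i =
         - \<rho> * (\<rho> * 1 - app ?I m (\<lambda>_. 1) i)"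
      using app_norm_bound[of ?I m \<rho> "\<lambda>_. 1"] m_sym m_nonneg bound \<open>\<rho> > 0\<close>
      unfolding dotT dot1 by auto
    have "?S \<noteq> \<rho>\<^sup>2 * real n"
    proof
      assume S: "?S = \<rho>\<^sup>2 * real n"
      define w where "w i = \<rho> - app ?I m (\<lambda>_. 1) i" for i
      have w: "app ?I m w i = - \<rho> * w i" if "i < n" for i
        using eq[OF S] that by (simp add: w_def[abs_def])
      have "w i = 0" if "i < n" for i
      \<comment> \<open>For \<open>\<alpha> = 1\<close> the matrix is diagonal, so the eigenvector
        equation decouples; otherwise the off-diagonal entries are positive and the sign argument
        applies.\<close>
      proof (cases "\<alpha> = 1")
        case True
        have "app ?I m w i = (\<Sum>j<n. if i = j then T i * w j else 0)"
          unfolding app_def using that by (intro sum.cong) (auto simp: m True)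
        then have "(T i + \<rho>) * w i = 0"
          using w[OF that] that by (simp add: algebra_simps)
        then show ?thesis using T_nonneg[of i] \<open>\<rho> > 0\<close> by auto
      next
        case False
        then have "0 < m i j" if "i < n" "j < n" "i \<noteq> j" for i j
          using that d_pos assms(6) by (simp add: m)
        then show ?thesis
          using no_negative_extremal_eigenvector[of ?I m \<rho> w i] m_sym m_nonneg bound w that n3
          by auto
      qed
      \<comment> \<open>\<open>w = 0\<close> makes every transmission equal to
        \<open>\<rho>\<close>, against non-regularity.\<close>
      then have "T i = \<rho>" if "i < n" for i using one that by (simp add: w_def)
      with False show False by metis
    qed
    with le have "?S / real n < \<rho>\<^sup>2" using \<open>n > 0\<close> by (simp add: field_simps)
    then have "sqrt (?S / real n) < \<rho>" using \<open>\<rho> > 0\<close> by (intro real_less_lsqrt) auto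
    with False show ?thesis by (metis less_imp_le less_irrefl)
  qed
  then show ?thesis by (simp add: reg T_def)
qed

end
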